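(* Let $(X,d)$ be a metric space. The following are equivalent: (i) $X$ has sharp measure zero; (ii) $\overline{\mathcal H}^h(X)=0$ for every gauge $h$; (iii) $\overline{\dim}_H f(X)=0$ for every uniformly continuous mapping $f$ from $X$ into a metric space; (iv) $\overline{\dim}_H(X,\rho)=0$ for every metric $\rho$ on $X$ uniformly equivalent to $d$.
   Context: A gauge is a non-decreasing right-continuous $h:[0,\infty)\to[0,\infty)$ with $h(0)=0$ and $h(r)>0$ for $r>0$. For $E$ in a metric space: $\mathcal H^h(E)=\sup_{\delta>0}\inf\{\sum_n h(\operatorname{diam}E_n)\}$, infimum over countable covers of $E$ by sets of diameter $\le\delta$; $\dim_H E=\inf\{s>0:\mathcal H^s(E)=0\}$ where $\mathcal H^s$ uses $h(r)=r^s$. Upper Hausdorff measure: $\overline{\mathcal H}^h_\delta(E)=\inf\{\sum_{n=0}^N h(\operatorname{diam}E_n)\}$ over finite covers $\{E_n:n\le N\}$ of $E$ with $\operatorname{diam}E_n\le\delta$; $\overline{\mathcal H}^h_0(E)=\sup_{\delta>0}\overline{\mathcal H}^h_\delta(E)$; $\overline{\mathcal H}^h(E)=\inf\{\sum_n\overline{\mathcal H}^h_0(E_n):E\subseteq\bigcup_nE_n\}$. Upper Hausdorff dimension: $\overline{\dim}_H E=\inf\{s>0:\overline{\mathcal H}^s(E)=0\}$ with $\overline{\mathcal H}^s$ for $h(r)=r^s$. A metric space $X$ has sharp measure zero if for every uniformly continuous map $f:X\to Y$ into a complete metric space $Y$ there is a $\sigma$-compact $K\subseteq Y$ with $f(X)\subseteq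 K$ and $\dim_H K=0$. *)

theory Defs
  imports "HOL-Analysis.Analysis"
begin

definition gauge_fun :: "(real \<Rightarrow> real) \<Rightarrow> bool" where
  "gauge_fun h \<longleftrightarrow>
     mono_on {0..} h \<and> (\<forall>r\<ge>0. continuous (at_right r) h) \<and> h 0 = 0 \<and> (\<forall>r>0. h r > 0)"

(* The diameter lives in [0,\<infinity>], so unbounded sets have diameter \<infinity>; the empty set has diameter 0. *)
definition mdiam :: "'a metric \<Rightarrow> 'a set \<Rightarrow> ennreal" where
  "mdiam m E = (SUP x\<in>E. SUP y\<in>E. ennreal (mdist m x y))"

(* Only used for sets of finite diameter, where enn2real loses nothing. *)
definition gauge_cost :: "'a metric \<Rightarrow> (real \<Rightarrow> real) \<Rightarrow> 'a set \<Rightarrow> ennreal" where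
  "gauge_cost m h E = ennreal (h (enn2real (mdiam m E)))"

(* Countable covers are indexed by nat; shorter ones are padded with the empty set,
   which costs h 0 = 0. *)
definition hausdorff_delta :: "'a metric \<Rightarrow> (real \<Rightarrow> real) \<Rightarrow> real \<Rightarrow> 'a set \<Rightarrow> ennreal" where
  "hausdorff_delta m h \<delta> E =
     Inf {(\<Sum>n. gauge_cost m h (C n)) | C :: nat \<Rightarrow> 'a set.
            (\<forall>n. C n \<subseteq> mspace m \<and> mdiam m (C n) \<le> ennreal \<delta>) \<and> E \<subseteq> (\<Union>n. C n)}"

definition hausdorff_meas :: "'a metric \<Rightarrow> (real \<Rightarrow> real) \<Rightarrow> 'a set \<Rightarrow> ennreal" where
  "hausdorff_meas m h E = (SUP \<delta>\<in>{0<..}. hausdorff_delta m h \<delta> E)"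

definition hausdorff_dim :: "'a metric \<Rightarrow> 'a set \<Rightarrow> ennreal" where
  "hausdorff_dim m E =
     Inf {ennreal s | s. s > 0 \<and> hausdorff_meas m (\<lambda>r. r powr s) E = 0}"

definition upper_hausdorff_delta :: "'a metric \<Rightarrow> (real \<Rightarrow> real) \<Rightarrow> real \<Rightarrow> 'a set \<Rightarrow> ennreal" where
  "upper_hausdorff_delta m h \<delta> E =
     Inf {(\<Sum>n\<le>N. gauge_cost m h (C n)) | (N :: nat) (C :: nat \<Rightarrow> 'a set).
            (\<forall>n\<le>N. C n \<subseteq> mspace m \<and> mdiam m (C n) \<le> ennreal \<delta>) \<and> E \<subseteq> (\<Union>n\<le>N. C n)}"

definition upper_hausdorff_0 :: "'a metric \<Rightarrow> (real \<Rightarrow> real) \<Rightarrow> 'a set \<Rightarrow> ennreal" where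
  "upper_hausdorff_0 m h E = (SUP \<delta>\<in>{0<..}. upper_hausdorff_delta m h \<delta> E)"

definition upper_hausdorff_meas :: "'a metric \<Rightarrow> (real \<Rightarrow> real) \<Rightarrow> 'a set \<Rightarrow> ennreal" where
  "upper_hausdorff_meas m h E =
     Inf {(\<Sum>n. upper_hausdorff_0 m h (C n)) | C :: nat \<Rightarrow> 'a set.
            (\<forall>n. C n \<subseteq> mspace m) \<and> E \<subseteq> (\<Union>n. C n)}"

definition upper_hausdorff_dim :: "'a metric \<Rightarrow> 'a set \<Rightarrow> ennreal" where
  "upper_hausdorff_dim m E =
     Inf {ennreal s | s. s > 0 \<and> upper_hausdorff_meas m (\<lambda>r. r powr s) E = 0}"

definition sigma_compact_in :: "'a topology \<Rightarrow> 'a set \<Rightarrow> bool" where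
  "sigma_compact_in T K \<longleftrightarrow> (\<exists>C :: nat \<Rightarrow> 'a set. (\<forall>n. compactin T (C n)) \<and> K = (\<Union>n. C n))"

(* HOL has no quantifier over types, so the type 'b of the points of the complete target
   space Y is a parameter.  Replacing Y by the closure of f(X), whose points are limits of
   sequences in f(X), shows that TYPE('a \<Rightarrow> real) is large enough to capture all
   complete metric spaces. *)
definition sharp_measure_zero :: "'b itself \<Rightarrow> 'a metric \<Rightarrow> bool" where
  "sharp_measure_zero TYPE('b) X \<longleftrightarrow>
     (\<forall>(Y :: 'b metric) f. mcomplete_of Y \<and> uniformly_continuous_map X Y f \<longrightarrow>
        (\<exists>K. sigma_compact_in (mtopology_of Y) K \<and> f ` mspace X \<subseteq> K \<and> hausdorff_dim Y K = 0))"

definition uniformly_equivalent_metrics :: "'a metric \<Rightarrow> 'a metric \<Rightarrow> bool" where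
  "uniformly_equivalent_metrics m1 m2 \<longleftrightarrow>
     mspace m1 = mspace m2 \<and>
     uniformly_continuous_map m1 m2 id \<and> uniformly_continuous_map m2 m1 id"

end

theory Submission
  imports Defs "HOL-Real_Asymp.Real_Asymp"
begin

text \<open>
  For a gauge \<open>h\<close> there is a subadditive gauge \<open>g\<close> dominating \<open>h\<close> near \<open>0\<close>; then \<open>\<rho> = g \<circ> d\<close> is a metric
  uniformly equivalent to \<open>d\<close>, and the one-dimensional cost for \<open>\<rho>\<close> dominates the \<open>h\<close>-cost for \<open>d\<close>.
  Hence (iv) implies (ii). Conversely, a uniformly continuous map has a gauge as modulus of
  continuity, which may be composed with any gauge on the target; this gives (iii) from (ii).

  For (i) from (ii), use the gauge \<open>1 / ln (1 + 1 / r)\<close>, which dominates all powers: the image is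
  covered by countably many sets with finite upper premeasure. These are totally bounded, so their
  closures are compact, and the closures of finite covers show that they have dimension zero.
  For (ii) from (i), embed \<open>(X, \<rho>)\<close> into its completion: on a compact set, a countable cover by
  slightly enlarged open sets reduces to a finite one, so Hausdorff and upper Hausdorff null sets
  agree.
\<close>

section \<open>Diameters and gauges\<close>

lemma ennreal_eq_0I:
  fixes x :: ennreal
  assumes "\<And>e. 0 < e \<Longrightarrow> x \<le> ennreal e"
  shows "x = 0"
proof -
  have "x \<le> 0"
  proof (rule ennreal_le_epsilon)
    fix e :: real assume "0 < e"
    then have "x \<le> ennreal e" by (rule assms)
    then show "x \<le> 0 + ennreal e" by simp
  qed
  then show ?thesis by simp
qed

lemma mdist_le_mdiam:
  assumes "x \<in> E" "y \<in> E"
  shows "ennreal (mdist m x y) \<le> mdiam m E"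
  unfolding mdiam_def by (rule SUP_upper2[OF assms(1)], rule SUP_upper2[OF assms(2)]) simp

lemma mdiam_le_iff: "mdiam m E \<le> c \<longleftrightarrow> (\<forall>x\<in>E. \<forall>y\<in>E. ennreal (mdist m x y) \<le> c)"
  by (simp add: mdiam_def SUP_le_iff)

lemma mdiam_mono: "E \<subseteq> F \<Longrightarrow> mdiam m E \<le> mdiam m F"
  by (meson mdiam_le_iff mdist_le_mdiam subsetD)

text \<open>Replacing two points of the closure by points of \<open>E\<close> within
  \<open>e / 2\<close> changes their distance by at most \<open>e\<close>. Hence replacing the
  members of a cover by their closures does not change its cost.\<close>

lemma mdiam_closure_of:
  assumes "E \<subseteq> mspace m"
  shows "mdiam m (mtopology_of m closure_of E) = mdiam m E"
proof (rule antisym)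
  interpret Metric_space "mspace m" "mdist m" by simp
  show "mdiam m (mtopology_of m closure_of E) \<le> mdiam m E"
    unfolding mdiam_le_iff
  proof (intro ballI)
    fix x y
    assume x: "x \<in> mtopology_of m closure_of E" and y: "y \<in> mtopology_of m closure_of E"
    show "ennreal (mdist m x y) \<le> mdiam m E"
    proof (rule ennreal_le_epsilon)
      fix e :: real
      assume "e > 0"
      then have "e / 2 > 0" by simp
      obtain x' where x': "x' \<in> E" "x \<in> mspace m" "x' \<in> mspace m" "mdist m x x' < e / 2"
        using x \<open>e / 2 > 0\<close> unfolding mtopology_of_def metric_closure_of in_mball mem_Collect_eq by blast
      obtain y' where y': "y' \<in> E" "y \<in> mspace m" "y' \<in> mspace m" "mdist m y y' < e / 2"
        using y \<open>e / 2 > 0\<close> unfolding mtopology_of_def metric_closure_of in_mball mem_Collect_eq by blast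
      have "mdist m x y \<le> mdist m x x' + mdist m x' y" "mdist m x' y \<le> mdist m x' y' + mdist m y' y"
        using x' y' triangle by auto
      then have "mdist m x y \<le> mdist m x' y' + e"
        using x' y' commute[of y y'] by linarith
      then have "ennreal (mdist m x y) \<le> ennreal (mdist m x' y') + ennreal e"
        using \<open>e > 0\<close> by (simp add: ennreal_leI flip: ennreal_plus)
      also have "\<dots> \<le> mdiam m E + ennreal e"
        by (intro add_right_mono mdist_le_mdiam x' y')
      finally show "ennreal (mdist m x y) \<le> mdiam m E + ennreal e" .
    qed
  qed
  show "mdiam m E \<le> mdiam m (mtopology_of m closure_of E)"
    by (intro mdiam_mono closure_of_subset) (simp add: assms)
qed

section \<open>Gauges: a criterion for right-continuity, composition, and examples\<close>

lemma gauge_funI: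
  assumes mono: "mono_on {0..} h"
    and right: "\<And>r e. 0 \<le> r \<Longrightarrow> 0 < e \<Longrightarrow> \<exists>r'>r. h r' < h r + e"
    and "h 0 = 0" "\<And>r. 0 < r \<Longrightarrow> 0 < h r"
  shows "gauge_fun h"
proof -
  \<comment> \<open>Monotonicity gives the lower estimate for free, and a single
    \<open>r' > r\<close> with a good value bounds \<open>h\<close> on the whole interval up to
    \<open>r'\<close>.\<close>
  have "(h \<longlongrightarrow> h r) (at_right r)" if "0 \<le> r" for r
  proof (rule order_tendstoI)
    fix a assume "a < h r"
    show "\<forall>\<^sub>F x in at_right r. a < h x"
      unfolding eventually_at_right_field
    proof (intro exI[of _ "r + 1"] conjI allI impI)
      fix x assume "r < x" "x < r + 1"
      then have "h r \<le> h x" using that by (intro mono_onD[OF mono]) auto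
      then show "a < h x" using \<open>a < h r\<close> by simp
    qed simp
  next
    fix a assume "h r < a"
    then obtain r' where r': "r' > r" "h r' < a"
      using right[of r "a - h r"] \<open>0 \<le> r\<close> by auto
    show "\<forall>\<^sub>F x in at_right r. h x < a"
      unfolding eventually_at_right_field
    proof (intro exI[of _ r'] conjI allI impI)
      fix x assume "r < x" "x < r'"
      then have "h x \<le> h r'" using that by (intro mono_onD[OF mono]) auto
      then show "h x < a" using r' by simp
    qed (fact r')
  qed
  then show ?thesis
    using assms by (auto simp: gauge_fun_def continuous_within)
qed

lemma gauge_fun_mono: "gauge_fun h \<Longrightarrow> 0 \<le> r \<Longrightarrow> r \<le> s \<Longrightarrow> h r \<le> h s"
  by (auto simp: gauge_fun_def mono_on_def)

lemma gauge_fun_zero: "gauge_fun h \<Longrightarrow> h 0 = 0"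
  and gauge_fun_pos: "gauge_fun h \<Longrightarrow> 0 < r \<Longrightarrow> 0 < h r"
  by (auto simp: gauge_fun_def)

lemma gauge_fun_nonneg: "gauge_fun h \<Longrightarrow> 0 \<le> r \<Longrightarrow> 0 \<le> h r"
  using gauge_fun_mono[of h 0 r] gauge_fun_zero[of h] by simp

text \<open>The converse of the criterion in \<open>gauge_funI\<close>. At \<open>r = 0\<close> it
  supplies scales at which a gauge is as small as desired.\<close>

lemma gauge_fun_right:
  assumes "gauge_fun h" "0 \<le> r" "0 < e"
  obtains r' where "r' > r" "h r' < h r + e"
proof -
  have "(h \<longlongrightarrow> h r) (at_right r)"
    using assms by (auto simp: gauge_fun_def continuous_within)
  then have "\<forall>\<^sub>F x in at_right r. h x < h r + e"
    by (rule order_tendstoD) (use assms in simp)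
  then obtain b where b: "b > r" "\<And>y. r < y \<Longrightarrow> y < b \<Longrightarrow> h y < h r + e"
    unfolding eventually_at_right_field by blast
  then show thesis
    using dense[OF b(1)] that by blast
qed

text \<open>Right-continuity of \<open>h\<close> leaves room up to some \<open>q > g r\<close>, and
  right-continuity of \<open>g\<close> keeps \<open>g r'\<close> below that
  \<open>q\<close>.\<close>

lemma gauge_fun_compose:
  assumes h: "gauge_fun h" and g: "gauge_fun g"
  shows "gauge_fun (\<lambda>r. h (g r))"
proof (rule gauge_funI)
  show "mono_on {0..} (\<lambda>r. h (g r))"
    by (auto simp: mono_on_def intro!: gauge_fun_mono[OF h] gauge_fun_mono[OF g] gauge_fun_nonneg[OF g])
  fix r e :: real assume r: "0 \<le> r" and e: "0 < e"
  obtain q where q: "q > g r" "h q < h (g r) + e"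
    using gauge_fun_right[OF h gauge_fun_nonneg[OF g r] e] by blast
  obtain r' where r': "r' > r" "g r' < g r + (q - g r)"
    using gauge_fun_right[OF g r, of "q - g r"] q by auto
  have "h (g r') \<le> h q"
    using r' r by (intro gauge_fun_mono[OF h] gauge_fun_nonneg[OF g]) auto
  then show "\<exists>r'>r. h (g r') < h (g r) + e"
    using r' q by (intro exI[of _ r']) auto
qed (use assms in \<open>auto simp: gauge_fun_zero gauge_fun_pos\<close>)

lemma gauge_fun_powr:
  assumes "s > 0"
  shows "gauge_fun (\<lambda>r. r powr s)"
proof (rule gauge_funI)
  show "mono_on {0..} (\<lambda>r. r powr s)"
    using assms by (auto simp: mono_on_def intro: powr_mono2)
  fix r e :: real assume r: "0 \<le> r" and e: "0 < e"
  \<comment> \<open>The right-hand side is the point where the power reaches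
    \<open>r powr s + e\<close>; every \<open>q\<close> strictly between serves as the required
    \<open>r'\<close>.\<close>
  have lt: "r < (r powr s + e) powr (1 / s)"
  proof -
    have "r = (r powr s) powr (1 / s)" using assms r by (simp add: powr_powr)
    also have "\<dots> < (r powr s + e) powr (1 / s)"
      using assms e by (intro powr_less_mono2) auto
    finally show ?thesis .
  qed
  then obtain q where q: "r < q" "q < (r powr s + e) powr (1 / s)" using dense by blast
  have "q powr s < ((r powr s + e) powr (1 / s)) powr s"
    using q r assms by (intro powr_less_mono2) auto
  also have "\<dots> = r powr s + e"
    using assms e powr_ge_zero[of r s] by (simp add: powr_powr)
  finally show "\<exists>r'>r. r' powr s < r powr s + e" using q by blast
qed (use assms in auto)

text \<open>At \<open>r = 0\<close> the formula gives \<open>1 / ln 1 = 0\<close>, thanks to \<open>1 / 0 = 0\<close>.\<close>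

lemma gauge_fun_inverse_ln: "gauge_fun (\<lambda>r. 1 / ln (1 + 1 / r))"
proof -
  have mono: "mono_on {0..} (\<lambda>r::real. 1 / ln (1 + 1 / r))"
  proof (rule mono_onI)
    fix r s :: real assume "r \<in> {0..}" "s \<in> {0..}" "r \<le> s"
    show "1 / ln (1 + 1 / r) \<le> 1 / ln (1 + 1 / s)"
    proof (cases "r = 0")
      case True
      then show ?thesis using \<open>s \<in> {0..}\<close> by (auto intro!: ln_ge_zero)
    next
      case False
      then have "0 < r" using \<open>r \<in> {0..}\<close> by simp
      then have "0 < ln (1 + 1 / s)" using \<open>r \<le> s\<close> by (intro ln_gt_zero) simp
      moreover have "ln (1 + 1 / s) \<le> ln (1 + 1 / r)"
        using \<open>0 < r\<close> \<open>r \<le> s\<close> by (simp add: frac_le add_pos_pos)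
      ultimately show ?thesis by (simp add: frac_le)
    qed
  qed
  have pos: "0 < 1 / ln (1 + 1 / r)" if "0 < r" for r :: real
    using that by (simp add: ln_gt_zero)
  have "continuous (at_right r) (\<lambda>r::real. 1 / ln (1 + 1 / r))" if "r \<ge> 0" for r
  proof (cases "r = 0")
    case True
    have "((\<lambda>r::real. 1 / ln (1 + 1 / r)) \<longlongrightarrow> 0) (at_right 0)"
      by real_asymp
    then show ?thesis using True by (simp add: continuous_within)
  next
    case False
    with that have "0 < r" by simp
    then show ?thesis
      using pos[of r] add_pos_pos[of 1 "1 / r"] by (intro continuous_intros) auto
  qed
  then show ?thesis
    using mono pos by (auto simp: gauge_fun_def)
qed

text \<open>The majorant is concave, as an infimum of the affine functions \<open>r \<mapsto> \<omega> t + r / t\<close>;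
  they lie above \<open>\<omega>\<close> because \<open>\<omega> \<le> 1 \<le> r / t\<close> for \<open>r \<ge> t\<close>.\<close>

lemma subadditive_gauge_majorant:
  fixes \<omega> :: "real \<Rightarrow> real"
  assumes mono: "mono_on {0..} \<omega>"
    and bounds: "\<And>r. 0 \<le> r \<Longrightarrow> 0 \<le> \<omega> r" "\<And>r. 0 \<le> r \<Longrightarrow> \<omega> r \<le> 1"
    and small: "\<And>e. 0 < e \<Longrightarrow> \<exists>t>0. \<omega> t < e"
  shows "\<exists>g. gauge_fun g \<and> (\<forall>a\<ge>0. \<forall>b\<ge>0. g (a + b) \<le> g a + g b) \<and>
    (\<forall>r\<ge>0. r \<le> g r) \<and> (\<forall>r\<ge>0. \<omega> r \<le> g r)"
proof -
  \<comment> \<open>Restricting to \<open>t \<le> 1\<close> makes all slopes \<open>1 / t\<close> at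
    least 1, which is what yields \<open>r \<le> g r\<close>.\<close>
  define g where "g r = (INF t\<in>{0<..1}. \<omega> t + r / t)" for r
  have ne: "{0<..1::real} \<noteq> {}" by simp
  have bdd: "bdd_below ((\<lambda>t. \<omega> t + r / t) ` {0<..1})" if "0 \<le> r" for r
    using that bounds by (intro bdd_belowI2[of _ 0]) auto
  have upper: "g r \<le> \<omega> t + r / t" if "0 \<le> r" "0 < t" "t \<le> 1" for r t
    unfolding g_def using that by (intro cINF_lower bdd) auto
  have greatest: "c \<le> g r" if "\<And>t. 0 < t \<Longrightarrow> t \<le> 1 \<Longrightarrow> c \<le> \<omega> t + r / t" for c r
    unfolding g_def using that by (intro cINF_greatest ne) auto
  have approx: "\<exists>t. 0 < t \<and> t \<le> 1 \<and> \<omega> t + r / t < g r + e" if "0 < e" for r e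
    using greatest[of "g r + e" r] that by (meson less_add_same_cancel1 linorder_not_less)
  have gmono: "g r \<le> g s" if "0 \<le> r" "r \<le> s" for r s
  proof (rule greatest)
    fix t :: real assume t: "0 < t" "t \<le> 1"
    have "g r \<le> \<omega> t + r / t" using upper t that by simp
    also have "\<dots> \<le> \<omega> t + s / t" using t that by (simp add: divide_right_mono)
    finally show "g r \<le> \<omega> t + s / t" .
  qed
  have ge: "r \<le> g r" if "0 \<le> r" for r
  proof (rule greatest)
    fix t :: real assume t: "0 < t" "t \<le> 1"
    have "r \<le> r / t" using t that by (simp add: field_simps mult_left_le)
    then show "r \<le> \<omega> t + r / t" using bounds(1)[of t] t by simp
  qed
  have dom: "\<omega> r \<le> g r" if "0 \<le> r" for r
  proof (rule greatest)
    fix t :: real assume t: "0 < t" "t \<le> 1"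
    show "\<omega> r \<le> \<omega> t + r / t"
    proof (cases "r \<le> t")
      case True
      then have "\<omega> r \<le> \<omega> t" using that t by (intro mono_onD[OF mono]) auto
      then show ?thesis using that t by (simp add: add_increasing2)
    next
      case False
      then have "1 \<le> r / t" using t by simp
      then show ?thesis using bounds(1)[of t] bounds(2)[OF that] t by linarith
    qed
  qed
  have "g 0 \<le> 0"
  proof (rule field_le_epsilon)
    fix e :: real assume "0 < e"
    then obtain t where t: "t > 0" "\<omega> t < e" using small by blast
    have "\<omega> (min t 1) \<le> \<omega> t" using t by (intro mono_onD[OF mono]) auto
    then show "g 0 \<le> 0 + e" using upper[of 0 "min t 1"] t by simp
  qed
  then have g0: "g 0 = 0" using ge[of 0] by simp
  have gauge: "gauge_fun g"
  proof (rule gauge_funI)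
    show "mono_on {0..} g" by (auto simp: mono_on_def gmono)
    show "g 0 = 0" by fact
    show "0 < g r" if "0 < r" for r using ge[of r] that by simp
    fix r e :: real assume r: "0 \<le> r" and e: "0 < e"
    then obtain t where t: "0 < t" "t \<le> 1" "\<omega> t + r / t < g r + e / 2"
      using approx[of "e / 2" r] by auto
    \<comment> \<open>The affine function chosen at \<open>r\<close> has slope \<open>1 / t\<close>,
      so a move by \<open>e * t / 2\<close> raises it by exactly \<open>e / 2\<close>.\<close>
    have "g (r + e * t / 2) \<le> \<omega> t + (r + e * t / 2) / t"
      using r e t by (intro upper) auto
    also have "\<dots> = \<omega> t + r / t + e / 2" using t by (simp add: field_simps)
    finally show "\<exists>r'>r. g r' < g r + e"
      using t e by (intro exI[of _ "r + e * t / 2"]) auto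
  qed
  have sub: "g (a + b) \<le> g a + g b" if ab: "0 \<le> a" "0 \<le> b" for a b
  proof (rule field_le_epsilon)
    fix e :: real assume "0 < e"
    then obtain t u where t: "0 < t" "t \<le> 1" "\<omega> t + a / t < g a + e / 2"
      and u: "0 < u" "u \<le> 1" "\<omega> u + b / u < g b + e / 2"
      using approx[of "e / 2" a] approx[of "e / 2" b] by auto
    \<comment> \<open>The larger scale has the smaller slope, so it improves both linear terms; its
      constant \<open>\<omega> v\<close> is one of \<open>\<omega> t\<close> and
      \<open>\<omega> u\<close>, hence at most their sum.\<close>
    define v where "v = max t u"
    have v: "0 < v" "v \<le> 1" "t \<le> v" "u \<le> v" using t u by (auto simp: v_def)
    have "a / v \<le> a / t" "b / v \<le> b / u"
      using v t u ab by (auto intro!: divide_left_mono)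
    moreover have "\<omega> v \<le> \<omega> t + \<omega> u"
      using bounds(1)[of t] bounds(1)[of u] t u by (auto simp: v_def max_def)
    moreover have "g (a + b) \<le> \<omega> v + (a / v + b / v)"
      using upper[of "a + b" v] v ab by (simp add: add_divide_distrib)
    ultimately show "g (a + b) \<le> g a + g b + e" using t u by linarith
  qed
  show ?thesis using gauge sub ge dom by blast
qed

section \<open>Comparison of upper Hausdorff measures\<close>

lemma ennreal_enn2real_mdiam:
  assumes "mdiam m E \<le> ennreal r"
  shows "ennreal (enn2real (mdiam m E)) = mdiam m E"
  using le_less_trans[OF assms ennreal_less_top] by (rule ennreal_enn2real)

lemma enn2real_mdiam_le:
  assumes "mdiam m E \<le> ennreal r" "0 \<le> r"
  shows "enn2real (mdiam m E) \<le> r"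
  using assms by (simp add: enn2real_leI)

lemma gauge_cost_le:
  assumes "gauge_fun h" "mdiam m E \<le> ennreal r" "0 \<le> r"
  shows "gauge_cost m h E \<le> ennreal (h r)"
  unfolding gauge_cost_def
  by (intro ennreal_leI gauge_fun_mono[OF assms(1)] enn2real_mdiam_le assms) simp

lemma gauge_cost_empty: "gauge_fun h \<Longrightarrow> gauge_cost m h {} = 0"
  by (simp add: gauge_cost_def mdiam_def gauge_fun_zero bot_ennreal)

lemma gauge_cost_powr_1:
  assumes "mdiam m E \<le> ennreal r"
  shows "gauge_cost m (\<lambda>r. r powr 1) E = mdiam m E"
  by (simp add: gauge_cost_def ennreal_enn2real_mdiam[OF assms])

text \<open>On \<open>[0, 1]\<close> an exponent of at most 1 can only increase a number. This turns
  cheap covers for a small exponent into cheap covers for exponent 1.\<close>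

lemma mdiam_le_gauge_cost_powr:
  assumes "mdiam m E \<le> 1" "0 < s" "s \<le> 1"
  shows "mdiam m E \<le> gauge_cost m (\<lambda>r. r powr s) E"
proof -
  define r where "r = enn2real (mdiam m E)"
  have r: "mdiam m E = ennreal r" "0 \<le> r" "r \<le> 1"
    using ennreal_enn2real_mdiam[of m E 1] enn2real_mdiam_le[of m E 1] assms(1) by (auto simp: r_def)
  have "r \<le> r powr s"
  proof (cases "r = 0")
    case False
    then have "r powr 1 \<le> r powr s" using r assms by (intro powr_mono') auto
    then show ?thesis using r by simp
  qed simp
  then show ?thesis
    unfolding gauge_cost_def r_def[symmetric] unfolding r(1) by (intro ennreal_leI)
qed

section \<open>Upper premeasures and measures, and their transport along relations\<close>

lemma upper_hausdorff_delta_le: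
  fixes N :: nat
  assumes "\<And>n. n \<le> N \<Longrightarrow> C n \<subseteq> mspace m" "\<And>n. n \<le> N \<Longrightarrow> mdiam m (C n) \<le> ennreal \<delta>"
    "E \<subseteq> (\<Union>n\<le>N. C n)"
  shows "upper_hausdorff_delta m h \<delta> E \<le> (\<Sum>n\<le>N. gauge_cost m h (C n))"
  unfolding upper_hausdorff_delta_def
  by (intro Inf_lower CollectI exI[of _ N] exI[of _ C]) (use assms in auto)

lemma upper_hausdorff_delta_lessE:
  assumes "upper_hausdorff_delta m h \<delta> E < c"
  obtains N :: nat and C where "\<forall>n\<le>N. C n \<subseteq> mspace m \<and> mdiam m (C n) \<le> ennreal \<delta>"
    "E \<subseteq> (\<Union>n\<le>N. C n)" "(\<Sum>n\<le>N. gauge_cost m h (C n)) < c"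
  using assms unfolding upper_hausdorff_delta_def Inf_less_iff by blast

lemma upper_hausdorff_delta_le_0:
  "0 < \<delta> \<Longrightarrow> upper_hausdorff_delta m h \<delta> E \<le> upper_hausdorff_0 m h E"
  unfolding upper_hausdorff_0_def by (intro SUP_upper) auto

lemma upper_hausdorff_meas_le:
  fixes C :: "nat \<Rightarrow> 'a set"
  assumes "\<And>n. C n \<subseteq> mspace m" "E \<subseteq> (\<Union>n. C n)"
  shows "upper_hausdorff_meas m h E \<le> (\<Sum>n. upper_hausdorff_0 m h (C n))"
  unfolding upper_hausdorff_meas_def
  by (intro Inf_lower CollectI exI[of _ C]) (use assms in auto)

lemma upper_hausdorff_meas_lessE:
  assumes "upper_hausdorff_meas m h E < c"
  obtains C :: "nat \<Rightarrow> 'a set" where "\<And>n. C n \<subseteq> mspace m" "E \<subseteq> (\<Union>n. C n)" "(\<Sum>n. upper_hausdorff_0 m h (C n)) < c"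
  using assms unfolding upper_hausdorff_meas_def Inf_less_iff by blast

text \<open>The images of a fine cover form a fine cover of the image at no greater cost. A relation
  \<open>R\<close> accommodates graphs of maps, inverses of embeddings defined on part of the
  target, and \<open>Id\<close> alike.\<close>

lemma upper_hausdorff_0_Image_le:
  assumes R: "R `` mspace m1 \<subseteq> mspace m2"
    and fine: "\<And>\<delta>. 0 < \<delta> \<Longrightarrow> \<exists>\<delta>'>0. \<forall>E\<subseteq>mspace m1. mdiam m1 E \<le> ennreal \<delta>' \<longrightarrow>
        mdiam m2 (R `` E) \<le> ennreal \<delta> \<and> gauge_cost m2 h2 (R `` E) \<le> gauge_cost m1 h1 E"
  shows "upper_hausdorff_0 m2 h2 (R `` D) \<le> upper_hausdorff_0 m1 h1 D"
  unfolding upper_hausdorff_0_def[of m2]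
proof (rule SUP_least)
  fix \<delta> :: real assume "\<delta> \<in> {0<..}"
  then obtain \<delta>' where \<delta>': "\<delta>' > 0" and *: "\<And>E. E \<subseteq> mspace m1 \<Longrightarrow> mdiam m1 E \<le> ennreal \<delta>' \<Longrightarrow>
      mdiam m2 (R `` E) \<le> ennreal \<delta> \<and> gauge_cost m2 h2 (R `` E) \<le> gauge_cost m1 h1 E"
    using fine[of \<delta>] by auto
  have "upper_hausdorff_delta m2 h2 \<delta> (R `` D) \<le> upper_hausdorff_delta m1 h1 \<delta>' D"
    unfolding upper_hausdorff_delta_def[of m1]
  proof (rule Inf_greatest, clarify)
    fix N :: nat and C
    assume C: "\<forall>n\<le>N. C n \<subseteq> mspace m1 \<and> mdiam m1 (C n) \<le> ennreal \<delta>'" and D: "D \<subseteq> (\<Union>n\<le>N. C n)"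
    have "upper_hausdorff_delta m2 h2 \<delta> (R `` D) \<le> (\<Sum>n\<le>N. gauge_cost m2 h2 (R `` C n))"
    proof (rule upper_hausdorff_delta_le)
      show "R `` C n \<subseteq> mspace m2" if "n \<le> N" for n
        using C that R by (meson Image_mono order_refl order_trans)
      show "mdiam m2 (R `` C n) \<le> ennreal \<delta>" if "n \<le> N" for n
        using C that * by blast
      show "R `` D \<subseteq> (\<Union>n\<le>N. R `` C n)"
        using D by blast
    qed
    also have "\<dots> \<le> (\<Sum>n\<le>N. gauge_cost m1 h1 (C n))"
      using C * by (intro sum_mono) auto
    finally show "upper_hausdorff_delta m2 h2 \<delta> (R `` D) \<le> (\<Sum>n\<le>N. gauge_cost m1 h1 (C n))" .
  qed
  also have "\<dots> \<le> upper_hausdorff_0 m1 h1 D"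
    by (rule upper_hausdorff_delta_le_0[OF \<delta>'])
  finally show "upper_hausdorff_delta m2 h2 \<delta> (R `` D) \<le> upper_hausdorff_0 m1 h1 D" .
qed

lemma upper_hausdorff_meas_Image_le:
  assumes R: "R `` mspace m1 \<subseteq> mspace m2"
    and fine: "\<And>\<delta>. 0 < \<delta> \<Longrightarrow> \<exists>\<delta>'>0. \<forall>E\<subseteq>mspace m1. mdiam m1 E \<le> ennreal \<delta>' \<longrightarrow>
        mdiam m2 (R `` E) \<le> ennreal \<delta> \<and> gauge_cost m2 h2 (R `` E) \<le> gauge_cost m1 h1 E"
  shows "upper_hausdorff_meas m2 h2 (R `` D) \<le> upper_hausdorff_meas m1 h1 D"
  unfolding upper_hausdorff_meas_def[of m1]
proof (rule Inf_greatest, clarify)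
  fix C :: "nat \<Rightarrow> _"
  assume C: "\<forall>n. C n \<subseteq> mspace m1" and D: "D \<subseteq> (\<Union>n. C n)"
  have "upper_hausdorff_meas m2 h2 (R `` D) \<le> (\<Sum>n. upper_hausdorff_0 m2 h2 (R `` C n))"
  proof (rule upper_hausdorff_meas_le)
    show "R `` C n \<subseteq> mspace m2" for n
      using C R by (meson Image_mono order_refl order_trans)
    show "R `` D \<subseteq> (\<Union>n. R `` C n)"
      using D by blast
  qed
  also have "\<dots> \<le> (\<Sum>n. upper_hausdorff_0 m1 h1 (C n))"
    by (intro suminf_le upper_hausdorff_0_Image_le assms) auto
  finally show "upper_hausdorff_meas m2 h2 (R `` D) \<le> (\<Sum>n. upper_hausdorff_0 m1 h1 (C n))" .
qed

section \<open>Upper dimension zero, moduli of continuity, and change of metric\<close>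

lemma upper_hausdorff_dim_eq_0_iff:
  "upper_hausdorff_dim m E = 0 \<longleftrightarrow>
    (\<forall>e>0. \<exists>s. 0 < s \<and> s < e \<and> upper_hausdorff_meas m (\<lambda>r. r powr s) E = 0)" (is "?L \<longleftrightarrow> ?R")
proof
  assume L: ?L
  show ?R
  proof (intro allI impI)
    fix e :: real assume "e > 0"
    then have "upper_hausdorff_dim m E < ennreal e" using L by simp
    then obtain s where "0 < s" "ennreal s < ennreal e" "upper_hausdorff_meas m (\<lambda>r. r powr s) E = 0"
      unfolding upper_hausdorff_dim_def Inf_less_iff by auto
    then show "\<exists>s. 0 < s \<and> s < e \<and> upper_hausdorff_meas m (\<lambda>r. r powr s) E = 0"
      by (auto simp: ennreal_less_iff)
  qed
next
  assume R: ?R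
  have "upper_hausdorff_dim m E \<le> ennreal e" if e: "e > 0" for e
  proof -
    obtain s where s: "0 < s" "s < e" "upper_hausdorff_meas m (\<lambda>r. r powr s) E = 0"
      using R e by blast
    then have "upper_hausdorff_dim m E \<le> ennreal s"
      unfolding upper_hausdorff_dim_def by (intro Inf_lower) blast
    also have "\<dots> \<le> ennreal e" using s by (intro ennreal_leI) simp
    finally show ?thesis .
  qed
  then show ?L by (rule ennreal_eq_0I)
qed

text \<open>The optimal modulus of continuity is monotone and small near 0, but it may vanish at
  positive arguments or jump from the right; \<open>subadditive_gauge_majorant\<close> repairs both.
  Truncation at 1 keeps the suprema finite and meets the boundedness condition of that
  lemma.\<close>

lemma uniformly_continuous_map_gauge:
  assumes f: "uniformly_continuous_map X Y f"
  obtains g where "gauge_fun g"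
    "\<And>x y. x \<in> mspace X \<Longrightarrow> y \<in> mspace X \<Longrightarrow> min 1 (mdist Y (f x) (f y)) \<le> g (mdist X x y)"
proof -
  \<comment> \<open>The inserted 0 keeps \<open>S t\<close> nonempty when the space is
    empty.\<close>
  define S where "S t = insert 0 {min 1 (mdist Y (f x) (f y)) | x y.
      x \<in> mspace X \<and> y \<in> mspace X \<and> mdist X x y \<le> t}" for t
  have S: "u \<le> 1" "0 \<le> u" if "u \<in> S t" for u t
    using that by (auto simp: S_def)
  have bdd: "bdd_above (S t)" for t
    using S by (meson bdd_aboveI)
  have ne: "S t \<noteq> {}" for t by (simp add: S_def)
  have "mono_on {0..} (\<lambda>t. Sup (S t))"
    by (rule mono_onI, rule cSup_subset_mono[OF ne bdd]) (fastforce simp: S_def)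
  moreover have "0 \<le> Sup (S t)" "Sup (S t) \<le> 1" if "0 \<le> t" for t
    by (rule cSup_upper[OF _ bdd], simp add: S_def) (rule cSup_least[OF ne S(1)])
  moreover have "\<exists>t>0. Sup (S t) < e" if e: "0 < e" for e
  proof -
    obtain \<delta> where \<delta>: "\<delta> > 0"
      "\<And>x y. x \<in> mspace X \<Longrightarrow> y \<in> mspace X \<Longrightarrow> mdist X y x < \<delta> \<Longrightarrow> mdist Y (f y) (f x) < e / 2"
      using f half_gt_zero[OF e] unfolding uniformly_continuous_map_def by blast
    \<comment> \<open>Halving \<open>\<delta>\<close> reconciles the weak inequality in
      \<open>S\<close> with the strict one in uniform continuity; halving \<open>e\<close> keeps the
      supremum strictly below \<open>e\<close>.\<close>
    have "Sup (S (\<delta> / 2)) \<le> e / 2"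
    proof (rule cSup_least[OF ne])
      fix u assume "u \<in> S (\<delta> / 2)"
      then show "u \<le> e / 2"
        unfolding S_def
      proof (elim insertE CollectE exE conjE)
        fix x y assume "u = min 1 (mdist Y (f x) (f y))" "x \<in> mspace X" "y \<in> mspace X" "mdist X x y \<le> \<delta> / 2"
        then show "u \<le> e / 2" using \<delta>(1) \<delta>(2)[of y x] by simp
      qed (use that in simp)
    qed
    then show ?thesis using \<delta>(1) that by (intro exI[of _ "\<delta> / 2"]) auto
  qed
  ultimately have "\<exists>g. gauge_fun g \<and> (\<forall>a\<ge>0. \<forall>b\<ge>0. g (a + b) \<le> g a + g b) \<and>
      (\<forall>r\<ge>0. r \<le> g r) \<and> (\<forall>r\<ge>0. Sup (S r) \<le> g r)"
    by (rule subadditive_gauge_majorant)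
  then obtain g where g: "gauge_fun g" "\<And>r. 0 \<le> r \<Longrightarrow> Sup (S r) \<le> g r" by blast
  show thesis
  proof (rule that[OF g(1)])
    fix x y assume "x \<in> mspace X" "y \<in> mspace X"
    then have "min 1 (mdist Y (f x) (f y)) \<le> Sup (S (mdist X x y))"
      by (intro cSup_upper bdd) (auto simp: S_def)
    then show "min 1 (mdist Y (f x) (f y)) \<le> g (mdist X x y)"
      using g(2)[of "mdist X x y"] by simp
  qed
qed

text \<open>With \<open>g\<close> a gauge modulus of \<open>f\<close>, the image of a small set of
  diameter \<open>r\<close> has diameter at most \<open>g r\<close>. Its cost for \<open>h\<close>
  is thus at most the cost of the original set for the gauge \<open>h (g r)\<close>, to which
  \<open>null\<close> applies.\<close>

lemma upper_hausdorff_meas_uniformly_continuous_image: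
  assumes f: "uniformly_continuous_map X Y f" and h: "gauge_fun h"
    and null: "\<And>h. gauge_fun h \<Longrightarrow> upper_hausdorff_meas X h (mspace X) = 0"
  shows "upper_hausdorff_meas Y h (f ` mspace X) = 0"
proof -
  obtain g where g: "gauge_fun g"
    and fg: "\<And>x y. x \<in> mspace X \<Longrightarrow> y \<in> mspace X \<Longrightarrow> min 1 (mdist Y (f x) (f y)) \<le> g (mdist X x y)"
    using uniformly_continuous_map_gauge[OF f] by blast
  define R where "R = {(x, f x) | x. x \<in> mspace X}"
  have Im: "R `` E = f ` E" if "E \<subseteq> mspace X" for E
    using that by (auto simp: R_def)
  have "upper_hausdorff_meas Y h (R `` mspace X) \<le> upper_hausdorff_meas X (\<lambda>r. h (g r)) (mspace X)"
  proof (rule upper_hausdorff_meas_Image_le)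
    show "R `` mspace X \<subseteq> mspace Y"
      using f by (auto simp: Im uniformly_continuous_map_def)
    fix \<delta> :: real assume "\<delta> > 0"
    \<comment> \<open>The bound by 1 makes the truncation in \<open>fg\<close> inactive on sets of
      diameter at most \<open>\<delta>'\<close>.\<close>
    then obtain \<delta>' where \<delta>': "\<delta>' > 0" "g \<delta>' < min \<delta> 1"
      using gauge_fun_right[OF g, of 0 "min \<delta> 1"] gauge_fun_zero[OF g] by auto
    have "mdiam Y (R `` E) \<le> ennreal \<delta> \<and> gauge_cost Y h (R `` E) \<le> gauge_cost X (\<lambda>r. h (g r)) E"
      if E: "E \<subseteq> mspace X" "mdiam X E \<le> ennreal \<delta>'" for E
    proof -
      define r where "r = enn2real (mdiam X E)"
      have r: "mdiam X E = ennreal r" "0 \<le> r" "r \<le> \<delta>'"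
        using ennreal_enn2real_mdiam[OF E(2)] enn2real_mdiam_le[OF E(2)] \<delta>' by (auto simp: r_def)
      have gr: "g r \<le> g \<delta>'" "0 \<le> g r"
        using gauge_fun_mono[OF g] gauge_fun_nonneg[OF g] r by auto
      have "mdist Y (f x) (f y) \<le> g r" if "x \<in> E" "y \<in> E" for x y
      proof -
        have "mdist X x y \<le> r"
          using mdist_le_mdiam[OF that, of X] r by simp
        then have "min 1 (mdist Y (f x) (f y)) \<le> g r"
          using fg[of x y] gauge_fun_mono[OF g, of "mdist X x y" r] that E by force
        then show ?thesis using gr \<delta>' by auto
      qed
      then have le: "mdiam Y (R `` E) \<le> ennreal (g r)"
        using E(1) by (auto simp: Im mdiam_le_iff intro!: ennreal_leI)
      then have "gauge_cost Y h (R `` E) \<le> ennreal (h (g r))"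
        by (rule gauge_cost_le[OF h _ gr(2)])
      moreover have "mdiam Y (R `` E) \<le> ennreal \<delta>"
        using le by (rule order_trans) (use gr \<delta>' in \<open>auto intro!: ennreal_leI\<close>)
      ultimately show ?thesis by (simp add: gauge_cost_def r_def)
    qed
    then show "\<exists>\<delta>'>0. \<forall>E\<subseteq>mspace X. mdiam X E \<le> ennreal \<delta>' \<longrightarrow>
        mdiam Y (R `` E) \<le> ennreal \<delta> \<and> gauge_cost Y h (R `` E) \<le> gauge_cost X (\<lambda>r. h (g r)) E"
      using \<delta>'(1) by blast
  qed
  also have "\<dots> = 0" by (rule null[OF gauge_fun_compose[OF h g]])
  finally show ?thesis by (simp add: Im)
qed

text \<open>The new metric is \<open>g \<circ> d\<close> for a subadditive majorant \<open>g\<close> of \<open>r \<mapsto> min 1 (h (2 * r))\<close>: a set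
  of \<open>d\<close>-diameter \<open>r\<close> has two points at distance at least \<open>r / 2\<close>, so the factor \<open>2\<close> replaces
  left-continuity of \<open>h\<close>.\<close>

lemma uniformly_equivalent_metric_gauge:
  fixes X :: "'a metric"
  assumes h: "gauge_fun h"
  obtains \<rho> where "uniformly_equivalent_metrics X \<rho>"
    "\<And>E. E \<subseteq> mspace X \<Longrightarrow> mdiam X E \<le> mdiam \<rho> E"
    "\<And>E. E \<subseteq> mspace X \<Longrightarrow> mdiam \<rho> E < 1 \<Longrightarrow> gauge_cost X h E \<le> mdiam \<rho> E"
proof -
  have "mono_on {0..} (\<lambda>t. min 1 (h (2 * t)))"
  proof (rule mono_onI)
    fix r s :: real assume "r \<in> {0..}" "s \<in> {0..}" "r \<le> s"
    then have "h (2 * r) \<le> h (2 * s)" by (intro gauge_fun_mono[OF h]) auto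
    then show "min 1 (h (2 * r)) \<le> min 1 (h (2 * s))" by auto
  qed
  moreover have "0 \<le> min 1 (h (2 * t))" "min 1 (h (2 * t)) \<le> 1" if "0 \<le> t" for t
    using gauge_fun_nonneg[OF h, of "2 * t"] that by auto
  moreover have "\<exists>t>0. min 1 (h (2 * t)) < e" if e: "0 < e" for e
  proof -
    obtain t where "t > 0" "h t < h 0 + e" using gauge_fun_right[OF h order_refl e] .
    then show ?thesis using gauge_fun_zero[OF h] by (intro exI[of _ "t / 2"]) auto
  qed
  ultimately have "\<exists>g. gauge_fun g \<and> (\<forall>a\<ge>0. \<forall>b\<ge>0. g (a + b) \<le> g a + g b) \<and>
      (\<forall>r\<ge>0. r \<le> g r) \<and> (\<forall>r\<ge>0. min 1 (h (2 * r)) \<le> g r)"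
    by (rule subadditive_gauge_majorant)
  then obtain g where g: "gauge_fun g"
    and sub: "\<forall>a\<ge>0. \<forall>b\<ge>0. g (a + b) \<le> g a + g b"
    and ge: "\<forall>r\<ge>0. r \<le> g r" and dom: "\<forall>r\<ge>0. min 1 (h (2 * r)) \<le> g r"
    by blast
  note sub = sub[rule_format] and ge = ge[rule_format] and dom = dom[rule_format]
  define d where "d x y = g (mdist X x y)" for x y
  interpret \<rho>: Metric_space "mspace X" d
  proof
    show "0 \<le> d x y" for x y by (simp add: d_def gauge_fun_nonneg[OF g])
    show "d x y = d y x" for x y by (simp add: d_def mdist_commute)
    show "d x y = 0 \<longleftrightarrow> x = y" if "x \<in> mspace X" "y \<in> mspace X" for x y
      using ge[of "mdist X x y"] that gauge_fun_zero[OF g] mdist_nonneg[of X x y]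
      by (metis antisym d_def mdist_zero)
    show "d x z \<le> d x y + d y z" if "x \<in> mspace X" "y \<in> mspace X" "z \<in> mspace X" for x y z
    proof -
      have "d x z \<le> g (mdist X x y + mdist X y z)"
        unfolding d_def by (intro gauge_fun_mono[OF g] mdist_triangle that) simp
      also have "\<dots> \<le> d x y + d y z" unfolding d_def by (intro sub) auto
      finally show ?thesis .
    qed
  qed
  define \<rho> where "\<rho> = metric (mspace X, d)"
  have \<rho>: "mspace \<rho> = mspace X" "mdist \<rho> = d" by (auto simp: \<rho>_def)
  \<comment> \<open>The inequality \<open>r \<le> g r\<close>, used above for definiteness, also
    makes the identity from \<open>\<rho>\<close> back to \<open>X\<close> 1-Lipschitz.\<close>
  have ge_d: "mdist X x y \<le> d x y" for x y by (simp add: d_def ge)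
  show thesis
  proof (rule that)
    have "uniformly_continuous_map X \<rho> id"
      unfolding uniformly_continuous_map_def
    proof (intro conjI allI impI)
      fix e :: real assume "e > 0"
      then obtain t where t: "t > 0" "g t < e"
        using gauge_fun_right[OF g, of 0 e] gauge_fun_zero[OF g] by auto
      have "mdist \<rho> (id y) (id x) < e" if "mdist X y x < t" for x y
        using gauge_fun_mono[OF g, of "mdist X y x" t] that t by (simp add: \<rho> d_def)
      then show "\<exists>\<delta>>0. \<forall>x\<in>mspace X. \<forall>y\<in>mspace X. mdist X y x < \<delta> \<longrightarrow> mdist \<rho> (id y) (id x) < e"
        using t(1) by blast
    qed (simp add: \<rho>)
    moreover have "uniformly_continuous_map \<rho> X id"
      unfolding uniformly_continuous_map_def
    proof (intro conjI allI impI)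
      fix e :: real assume "e > 0"
      have "mdist X (id y) (id x) < e" if "mdist \<rho> y x < e" for x y
        using ge_d[of y x] that by (simp add: \<rho>)
      then show "\<exists>\<delta>>0. \<forall>x\<in>mspace \<rho>. \<forall>y\<in>mspace \<rho>. mdist \<rho> y x < \<delta> \<longrightarrow> mdist X (id y) (id x) < e"
        using \<open>e > 0\<close> by blast
    qed (simp add: \<rho>)
    ultimately show "uniformly_equivalent_metrics X \<rho>"
      by (simp add: uniformly_equivalent_metrics_def \<rho>)
    show le: "mdiam X E \<le> mdiam \<rho> E" if "E \<subseteq> mspace X" for E
      unfolding mdiam_le_iff
    proof (intro ballI)
      fix x y assume "x \<in> E" "y \<in> E"
      have "ennreal (mdist X x y) \<le> ennreal (mdist \<rho> x y)" by (simp add: \<rho> ge_d ennreal_leI)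
      also have "\<dots> \<le> mdiam \<rho> E" by (rule mdist_le_mdiam) fact+
      finally show "ennreal (mdist X x y) \<le> mdiam \<rho> E" .
    qed
    show "gauge_cost X h E \<le> mdiam \<rho> E" if E: "E \<subseteq> mspace X" "mdiam \<rho> E < 1" for E
    proof -
      define r where "r = enn2real (mdiam X E)"
      have "mdiam X E \<le> ennreal 1" using le[OF E(1)] E(2) by simp
      then have r: "mdiam X E = ennreal r" "0 \<le> r"
        by (simp_all only: r_def ennreal_enn2real_mdiam enn2real_nonneg)
      show ?thesis
      proof (cases "r = 0")
        case True
        then show ?thesis by (simp add: gauge_cost_def r_def[symmetric] gauge_fun_zero[OF h])
      next
        case False
        have "\<not> mdiam X E \<le> ennreal (r / 2)" using r False by simp
        then obtain x y where xy: "x \<in> E" "y \<in> E" "r / 2 < mdist X x y"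
          unfolding mdiam_le_iff using r(2) by (auto simp: not_le ennreal_less_iff)
        have d: "ennreal (d x y) \<le> mdiam \<rho> E"
          using mdist_le_mdiam[OF xy(1,2), of \<rho>] by (simp add: \<rho>)
        then have "ennreal (d x y) < 1" using E(2) by (rule le_less_trans)
        \<comment> \<open>Strictness excludes the value 1 from the minimum in \<open>dom\<close>, so
          \<open>d x y\<close> bounds \<open>h (2 * mdist X x y)\<close> itself.\<close>
        then have "d x y < 1" by simp
        moreover have "min 1 (h (2 * mdist X x y)) \<le> d x y" by (simp add: d_def dom)
        moreover have "h r \<le> h (2 * mdist X x y)"
          using xy r by (intro gauge_fun_mono[OF h]) auto
        ultimately have "h r \<le> d x y" by auto
        then have "ennreal (h r) \<le> ennreal (d x y)" by (rule ennreal_leI)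
        then show ?thesis using d unfolding gauge_cost_def r_def[symmetric] by (rule order_trans)
      qed
    qed
  qed
qed

section \<open>Hausdorff dimension zero and compactness\<close>

lemma hausdorff_delta_le:
  fixes C :: "nat \<Rightarrow> 'a set"
  assumes "\<And>n. C n \<subseteq> mspace m" "\<And>n. mdiam m (C n) \<le> ennreal \<delta>" "E \<subseteq> (\<Union>n. C n)"
  shows "hausdorff_delta m h \<delta> E \<le> (\<Sum>n. gauge_cost m h (C n))"
  unfolding hausdorff_delta_def
  by (intro Inf_lower CollectI exI[of _ C]) (use assms in auto)

lemma hausdorff_delta_lessE:
  assumes "hausdorff_delta m h \<delta> E < c"
  obtains C :: "nat \<Rightarrow> 'a set" where "\<And>n. C n \<subseteq> mspace m" "\<And>n. mdiam m (C n) \<le> ennreal \<delta>"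
    "E \<subseteq> (\<Union>n. C n)" "(\<Sum>n. gauge_cost m h (C n)) < c"
  using assms unfolding hausdorff_delta_def Inf_less_iff by blast

lemma hausdorff_meas_eq_0_iff:
  "hausdorff_meas m h E = 0 \<longleftrightarrow> (\<forall>\<delta>>0. hausdorff_delta m h \<delta> E = 0)"
  unfolding hausdorff_meas_def
  by (metis SUP_upper SUP_least le_zero_eq greaterThan_iff)

lemma suminf_ennreal_geometric: "(\<Sum>n. ennreal (e * (1 / 2) ^ Suc n)) = ennreal e" if "0 \<le> e" for e :: real
proof -
  have "(\<lambda>n. e * (1 / 2) ^ Suc n) sums (e * 1)"
    by (intro sums_mult power_half_series)
  then show ?thesis using that by (intro sums_unique[symmetric] sums_ennreal[THEN iffD2]) auto
qed

text \<open>Each \<open>D n\<close> gets a cover of cost below \<open>e / 2 ^ (n + 1)\<close>. The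
  double family, enumerated by \<open>prod_decode\<close>, covers the union at total cost at most
  \<open>e\<close>.\<close>

lemma hausdorff_meas_UN_eq_0:
  fixes D :: "nat \<Rightarrow> 'a set"
  assumes "\<And>n. hausdorff_meas m h (D n) = 0"
  shows "hausdorff_meas m h (\<Union>n. D n) = 0"
  unfolding hausdorff_meas_eq_0_iff
proof (intro allI impI)
  fix \<delta> :: real assume \<delta>: "\<delta> > 0"
  have "hausdorff_delta m h \<delta> (\<Union>n. D n) \<le> ennreal e" if "e > 0" for e
  proof -
    have "\<exists>C. (\<forall>k. C k \<subseteq> mspace m \<and> mdiam m (C k) \<le> ennreal \<delta>) \<and> D n \<subseteq> (\<Union>k. C k) \<and>
        (\<Sum>k. gauge_cost m h (C k)) < ennreal (e * (1 / 2) ^ Suc n)" for n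
    proof -
      have "hausdorff_delta m h \<delta> (D n) = 0"
        using assms \<delta> by (simp add: hausdorff_meas_eq_0_iff)
      also have "0 < ennreal (e * (1 / 2) ^ Suc n)" using that by simp
      finally show ?thesis by (rule hausdorff_delta_lessE) blast
    qed
    then obtain C where C: "\<And>n k. C n k \<subseteq> mspace m" "\<And>n k. mdiam m (C n k) \<le> ennreal \<delta>"
      "\<And>n. D n \<subseteq> (\<Union>k. C n k)"
      "\<And>n. (\<Sum>k. gauge_cost m h (C n k)) < ennreal (e * (1 / 2) ^ Suc n)"
      by metis
    have "(\<Union>n. D n) \<subseteq> (\<Union>i. case_prod C (prod_decode i))"
    proof
      fix x assume "x \<in> (\<Union>n. D n)"
      then obtain n k where "x \<in> C n k" using C(3) by blast
      then have "x \<in> case_prod C (prod_decode (prod_encode (n, k)))" by simp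
      then show "x \<in> (\<Union>i. case_prod C (prod_decode i))" by (rule UN_I[OF UNIV_I])
    qed
    then have "hausdorff_delta m h \<delta> (\<Union>n. D n) \<le> (\<Sum>i. gauge_cost m h (case_prod C (prod_decode i)))"
      using C(1,2) by (intro hausdorff_delta_le) (auto split: prod.split)
    also have "\<dots> = (\<Sum>n. \<Sum>k. gauge_cost m h (C n k))"
      by (rule suminf_ennreal_2dimen[where f = "\<lambda>p. gauge_cost m h (case_prod C p)"]) simp
    also have "\<dots> \<le> (\<Sum>n. ennreal (e * (1 / 2) ^ Suc n))"
      using C(4) by (intro suminf_le) (auto intro: less_imp_le)
    also have "\<dots> = ennreal e" using that by (simp only: suminf_ennreal_geometric less_imp_le)
    finally show ?thesis by simp
  qed
  then show "hausdorff_delta m h \<delta> (\<Union>n. D n) = 0"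
    by (rule ennreal_eq_0I)
qed

lemma hausdorff_dim_eq_0I:
  assumes "\<And>s. s > 0 \<Longrightarrow> hausdorff_meas m (\<lambda>r. r powr s) E = 0"
  shows "hausdorff_dim m E = 0"
proof -
  have "hausdorff_dim m E \<le> ennreal e" if "e > 0" for e
    using assms that unfolding hausdorff_dim_def by (auto intro!: Inf_lower)
  then show ?thesis
    by (rule ennreal_eq_0I)
qed

text \<open>Dimension zero gives a null measure for some exponent \<open>s < 1\<close>. With the
  mesh capped at 1, each diameter is at most its power \<open>s\<close>, so the sum of the diameters
  is small too.\<close>

lemma hausdorff_dim_0_cover:
  assumes "hausdorff_dim m E = 0" "0 < \<delta>" "0 < e"
  obtains C :: "nat \<Rightarrow> 'a set" where "\<And>n. C n \<subseteq> mspace m" "\<And>n. mdiam m (C n) \<le> ennreal \<delta>"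
    "E \<subseteq> (\<Union>n. C n)" "(\<Sum>n. mdiam m (C n)) < ennreal e"
proof -
  have "hausdorff_dim m E < 1" using assms by simp
  then obtain s where s: "0 < s" "s < 1" and 0: "hausdorff_meas m (\<lambda>r. r powr s) E = 0"
    unfolding hausdorff_dim_def Inf_less_iff by auto
  have "hausdorff_delta m (\<lambda>r. r powr s) (min \<delta> 1) E = 0"
    using 0 assms(2) by (simp add: hausdorff_meas_eq_0_iff)
  also have "0 < ennreal e" using assms by simp
  finally obtain C where C: "\<And>n. C n \<subseteq> mspace m" "\<And>n. mdiam m (C n) \<le> ennreal (min \<delta> 1)"
    "E \<subseteq> (\<Union>n. C n)" "(\<Sum>n. gauge_cost m (\<lambda>r. r powr s) (C n)) < ennreal e"
    by (rule hausdorff_delta_lessE) blast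
  have le: "mdiam m (C n) \<le> ennreal \<delta>" "mdiam m (C n) \<le> 1" for n
    using order_trans[OF C(2)[of n] ennreal_leI[of "min \<delta> 1" \<delta>]]
      order_trans[OF C(2)[of n] ennreal_leI[of "min \<delta> 1" 1]] by auto
  have "(\<Sum>n. mdiam m (C n)) \<le> (\<Sum>n. gauge_cost m (\<lambda>r. r powr s) (C n))"
    using s le by (intro suminf_le mdiam_le_gauge_cost_powr) auto
  then show thesis using that[OF C(1) le(1) C(3)] C(4) by simp
qed

text \<open>Each end of a segment moves by less than \<open>\<eta>\<close>. The enlarged sets are
  unions of open balls, so they can feed a compactness argument.\<close>

lemma mdiam_UN_mball_le:
  assumes "E \<subseteq> mspace m" "0 \<le> \<eta>"
  shows "mdiam m (\<Union>x\<in>E. mball_of m x \<eta>) \<le> mdiam m E + ennreal (2 * \<eta>)"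
  unfolding mdiam_le_iff
proof (intro ballI)
  fix u v assume "u \<in> (\<Union>x\<in>E. mball_of m x \<eta>)" "v \<in> (\<Union>x\<in>E. mball_of m x \<eta>)"
  then obtain x y where x: "x \<in> E" "x \<in> mspace m" "u \<in> mspace m" "mdist m x u < \<eta>"
    and y: "y \<in> E" "y \<in> mspace m" "v \<in> mspace m" "mdist m y v < \<eta>" by auto
  have "mdist m u v \<le> mdist m u x + mdist m x v" "mdist m x v \<le> mdist m x y + mdist m y v"
    using x y by (auto intro: mdist_triangle)
  then have "mdist m u v \<le> mdist m x y + 2 * \<eta>"
    using x y mdist_commute[of m u x] by linarith
  then have "ennreal (mdist m u v) \<le> ennreal (mdist m x y) + ennreal (2 * \<eta>)"
    using assms by (simp add: ennreal_leI flip: ennreal_plus)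
  also have "\<dots> \<le> mdiam m E + ennreal (2 * \<eta>)"
    by (intro add_right_mono mdist_le_mdiam x y)
  finally show "ennreal (mdist m u v) \<le> mdiam m E + ennreal (2 * \<eta>)" .
qed

text \<open>A cheap countable cover of \<open>K\<close> is thickened to an open one with summable
  extra cost, and compactness of \<open>C\<close> leaves finitely many members.\<close>

lemma upper_hausdorff_0_compact_eq_0:
  assumes dim: "hausdorff_dim m K = 0" and C: "compactin (mtopology_of m) C" "C \<subseteq> K"
  shows "upper_hausdorff_0 m (\<lambda>r. r powr 1) C = 0"
proof -
  have "upper_hausdorff_delta m (\<lambda>r. r powr 1) \<delta> C \<le> ennreal e" if "\<delta> > 0" "e > 0" for \<delta> e
  proof -
    obtain E :: "nat \<Rightarrow> 'a set" where E: "\<And>n. E n \<subseteq> mspace m" "\<And>n. mdiam m (E n) \<le> ennreal (\<delta> / 2)"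
      "K \<subseteq> (\<Union>n. E n)" "(\<Sum>n. mdiam m (E n)) < ennreal (e / 2)"
      using hausdorff_dim_0_cover[OF dim, of "\<delta> / 2" "e / 2"] \<open>\<delta> > 0\<close> \<open>e > 0\<close> by auto
    \<comment> \<open>The first bound keeps the enlarged diameters within
      \<open>\<delta> / 2 + \<delta> / 2\<close>; the second makes the excesses
      \<open>2 * \<eta> n\<close> sum to at most \<open>e / 2\<close>.\<close>
    define \<eta> where "\<eta> n = min (\<delta> / 4) (e / 4 * (1 / 2) ^ Suc n)" for n
    have \<eta>: "0 < \<eta> n" "2 * \<eta> n \<le> \<delta> / 2" "2 * \<eta> n \<le> e / 2 * (1 / 2) ^ Suc n" for n
      using \<open>\<delta> > 0\<close> \<open>e > 0\<close> by (auto simp: \<eta>_def min_def)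
    define U where "U n = (\<Union>x\<in>E n. mball_of m x (\<eta> n))" for n
    have diamU: "mdiam m (U n) \<le> mdiam m (E n) + ennreal (2 * \<eta> n)" for n
      unfolding U_def using E(1) \<eta>(1)[of n] by (intro mdiam_UN_mball_le) auto
    have diamU': "mdiam m (U n) \<le> ennreal \<delta>" for n
    proof -
      have "mdiam m (U n) \<le> ennreal (\<delta> / 2) + ennreal (\<delta> / 2)"
        using diamU[of n] by (rule order_trans) (intro add_mono E(2) ennreal_leI \<eta>(2))
      also have "\<dots> = ennreal \<delta>" using \<open>\<delta> > 0\<close> by (simp flip: ennreal_plus)
      finally show ?thesis .
    qed
    have openU: "openin (mtopology_of m) (U n)" for n
      unfolding U_def mball_of_def mtopology_of_def
      by (intro openin_Union ballI) (auto simp: Metric_space.openin_mball)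
    have EU: "E n \<subseteq> U n" for n
    proof
      fix x assume "x \<in> E n"
      moreover have "x \<in> mball_of m x (\<eta> n)"
        using \<open>x \<in> E n\<close> E(1)[of n] \<eta>(1)[of n]
        by (auto simp: mball_of_def Metric_space.centre_in_mball_iff[OF Metric_space_mspace_mdist])
      ultimately show "x \<in> U n" unfolding U_def by (rule UN_I)
    qed
    have "C \<subseteq> \<Union> (range U)" using C(2) E(3) EU by blast
    then obtain F where F: "finite F" "F \<subseteq> range U" "C \<subseteq> \<Union> F"
      using compactinD[OF C(1), of "range U"] openU by blast
    obtain I where I: "finite I" "F = U ` I"
      using finite_subset_image[OF F(1,2)] by blast
    \<comment> \<open>Filling the finite index set up to an initial segment is harmless, since any
      partial sum is bounded by the full series.\<close>
    obtain N where N: "I \<subseteq> {..N}" using I(1) finite_nat_iff_bounded_le by blast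
    have "upper_hausdorff_delta m (\<lambda>r. r powr 1) \<delta> C \<le> (\<Sum>n\<le>N. gauge_cost m (\<lambda>r. r powr 1) (U n))"
    proof (rule upper_hausdorff_delta_le)
      show "U n \<subseteq> mspace m" for n by (auto simp: U_def)
      show "C \<subseteq> (\<Union>n\<le>N. U n)" using F(3) I(2) N by blast
    qed (rule diamU')
    also have "\<dots> = (\<Sum>n\<le>N. mdiam m (U n))"
      by (intro sum.cong refl gauge_cost_powr_1[OF diamU'])
    also have "\<dots> \<le> (\<Sum>n\<le>N. mdiam m (E n) + ennreal (e / 2 * (1 / 2) ^ Suc n))"
      by (intro sum_mono order_trans[OF diamU] add_left_mono ennreal_leI \<eta>(3))
    also have "\<dots> \<le> (\<Sum>n. mdiam m (E n) + ennreal (e / 2 * (1 / 2) ^ Suc n))"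
      by (intro sum_le_suminf) auto
    also have "\<dots> = (\<Sum>n. mdiam m (E n)) + (\<Sum>n. ennreal (e / 2 * (1 / 2) ^ Suc n))"
      by (intro suminf_add[symmetric]) auto
    also have "(\<Sum>n. ennreal (e / 2 * (1 / 2) ^ Suc n)) = ennreal (e / 2)"
      using \<open>e > 0\<close> by (intro suminf_ennreal_geometric) simp
    also have "(\<Sum>n. mdiam m (E n)) + ennreal (e / 2) \<le> ennreal (e / 2) + ennreal (e / 2)"
      using E(4) by (intro add_right_mono) simp
    also have "\<dots> = ennreal e" using \<open>e > 0\<close> by (simp flip: ennreal_plus)
    finally show ?thesis .
  qed
  then have "upper_hausdorff_delta m (\<lambda>r. r powr 1) \<delta> C = 0" if "\<delta> > 0" for \<delta>
    using that by (intro ennreal_eq_0I) blast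
  then have "upper_hausdorff_0 m (\<lambda>r. r powr 1) C \<le> 0"
    unfolding upper_hausdorff_0_def by (intro SUP_least) auto
  then show ?thesis by simp
qed

text \<open>The infimum over no covers is infinite, so a finite premeasure forces a finite cover at
  every mesh. Thus \<open>D\<close> is totally bounded, and completeness makes its closure
  compact.\<close>

lemma compactin_closure_of_upper_hausdorff_0:
  assumes Y: "mcomplete_of Y" and D: "D \<subseteq> mspace Y" and fin: "upper_hausdorff_0 Y h D < \<infinity>"
  shows "compactin (mtopology_of Y) (mtopology_of Y closure_of D)"
proof -
  interpret Metric_space "mspace Y" "mdist Y" by simp
  have "mtotally_bounded D"
    unfolding mtotally_bounded_def
  proof (intro allI impI)
    fix e :: real assume e: "e > 0"
    then have "upper_hausdorff_delta Y h (e / 2) D \<le> upper_hausdorff_0 Y h D"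
      by (intro upper_hausdorff_delta_le_0) simp
    also have "\<dots> < \<infinity>" by (fact fin)
    finally obtain N :: nat and C where "\<forall>n\<le>N. C n \<subseteq> mspace Y \<and> mdiam Y (C n) \<le> ennreal (e / 2)"
      and cover: "D \<subseteq> (\<Union>n\<le>N. C n)"
      by (rule upper_hausdorff_delta_lessE) blast
    then have C: "mdiam Y (C n) \<le> ennreal (e / 2)" if "n \<le> N" for n
      using that by blast
    \<comment> \<open>The centres must lie in \<open>D\<close>, so they are chosen in
      \<open>C n \<inter> D\<close>, and \<open>I\<close> below drops the members that miss
      \<open>D\<close>. Diameter \<open>e / 2\<close> places each remaining piece in the open ball
      of radius \<open>e\<close>.\<close>
    define p where "p n = (SOME x. x \<in> C n \<inter> D)" for n
    have p: "p n \<in> C n \<inter> D" if "x \<in> C n \<inter> D" for n x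
      unfolding p_def using that by (rule someI)
    define I where "I = {n. n \<le> N \<and> C n \<inter> D \<noteq> {}}"
    have "D \<subseteq> (\<Union>x\<in>p ` I. mball x e)"
    proof
      fix x assume x: "x \<in> D"
      then obtain n where n: "n \<le> N" "x \<in> C n" using cover by blast
      have pn: "p n \<in> C n" "p n \<in> D" using p[of x n] n x by auto
      have "ennreal (mdist Y (p n) x) \<le> ennreal (e / 2)"
        using mdist_le_mdiam[OF pn(1) n(2), of Y] C[OF n(1)] by (rule order_trans)
      then have "mdist Y (p n) x < e" using e by (simp add: ennreal_le_iff)
      then have "x \<in> mball (p n) e" using x pn D by auto
      moreover have "n \<in> I" using n x by (auto simp: I_def)
      ultimately show "x \<in> (\<Union>x\<in>p ` I. mball x e)" by blast
    qed
    moreover have "finite (p ` I)" by (simp add: I_def)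
    moreover have "p ` I \<subseteq> D" using p by (auto simp: I_def)
    ultimately show "\<exists>K. finite K \<and> K \<subseteq> D \<and> D \<subseteq> (\<Union>x\<in>K. mball x e)" by blast
  qed
  then show ?thesis
    using Y mtotally_bounded_eq_compact_closure_of by (simp add: mcomplete_of_def mtopology_of_def)
qed

text \<open>Every power \<open>r powr s\<close> is \<open>o(1 / ln (1 + 1 / r))\<close> as \<open>r\<close> tends to \<open>0\<close>.\<close>

lemma hausdorff_meas_closure_of_eq_0:
  assumes D: "D \<subseteq> mspace Y" and lt: "upper_hausdorff_0 Y (\<lambda>r. 1 / ln (1 + 1 / r)) D < 1" and s: "s > 0"
  shows "hausdorff_meas Y (\<lambda>r. r powr s) (mtopology_of Y closure_of D) = 0"
  unfolding hausdorff_meas_eq_0_iff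
proof (intro allI impI)
  fix \<delta> :: real assume \<delta>: "\<delta> > 0"
  define h :: "real \<Rightarrow> real" where "h = (\<lambda>r. 1 / ln (1 + 1 / r))"
  have "hausdorff_delta Y (\<lambda>r. r powr s) \<delta> (mtopology_of Y closure_of D) \<le> ennreal e" if e: "e > 0" for e
  proof -
    have "((\<lambda>r::real. r powr s * ln (1 + 1 / r)) \<longlongrightarrow> 0) (at_right 0)"
      using s by real_asymp
    then have "\<forall>\<^sub>F r in at_right 0. r powr s * ln (1 + 1 / r) < e"
      using e by (rule order_tendstoD)
    then obtain b where b: "b > 0" "\<And>r. 0 < r \<Longrightarrow> r < b \<Longrightarrow> r powr s * ln (1 + 1 / r) < e"
      unfolding eventually_at_right_field by blast
    have pow_le: "r powr s \<le> e * h r" if "0 \<le> r" "r < b" for r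
    proof (cases "r = 0")
      case False
      then have "0 < ln (1 + 1 / r)" using that by (intro ln_gt_zero) simp
      then show ?thesis using b(2)[of r] that False by (simp add: h_def field_simps)
    qed (simp add: h_def)
    define \<delta>' where "\<delta>' = min \<delta> (b / 2)"
    have \<delta>': "\<delta>' > 0" "\<delta>' \<le> \<delta>" "\<delta>' < b" using \<delta> b(1) by (auto simp: \<delta>'_def)
    have "upper_hausdorff_delta Y h \<delta>' D \<le> upper_hausdorff_0 Y h D"
      by (rule upper_hausdorff_delta_le_0[OF \<delta>'(1)])
    also have "\<dots> < 1" using lt by (simp add: h_def)
    finally obtain N :: nat and C where "\<forall>n\<le>N. C n \<subseteq> mspace Y \<and> mdiam Y (C n) \<le> ennreal \<delta>'"
      and cover: "D \<subseteq> (\<Union>n\<le>N. C n)" and small: "(\<Sum>n\<le>N. gauge_cost Y h (C n)) < 1"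
      by (rule upper_hausdorff_delta_lessE) blast
    then have C: "C n \<subseteq> mspace Y" "mdiam Y (C n) \<le> ennreal \<delta>'" if "n \<le> N" for n
      using that by blast+
    \<comment> \<open>Padding with empty sets, which cost 0, turns the finite cover into a sequence
      as \<open>hausdorff_delta\<close> requires.\<close>
    define E where "E n = (if n \<le> N then mtopology_of Y closure_of C n else {})" for n
    have cost: "gauge_cost Y (\<lambda>r. r powr s) (E n) \<le> ennreal e * gauge_cost Y h (C n)" if "n \<le> N" for n
    proof -
      have "enn2real (mdiam Y (C n)) < b"
        using enn2real_mdiam_le[OF C(2)[OF that]] \<delta>' by simp
      then have "enn2real (mdiam Y (C n)) powr s \<le> e * h (enn2real (mdiam Y (C n)))"
        by (intro pow_le) auto
      then show ?thesis
        using e that by (simp add: gauge_cost_def E_def mdiam_closure_of[OF C(1)] ennreal_leI flip: ennreal_mult')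
    qed
    have "hausdorff_delta Y (\<lambda>r. r powr s) \<delta> (mtopology_of Y closure_of D)
        \<le> (\<Sum>n. gauge_cost Y (\<lambda>r. r powr s) (E n))"
    proof (rule hausdorff_delta_le)
      show "E n \<subseteq> mspace Y" for n
        using closure_of_subset_topspace[of "mtopology_of Y" "C n"] by (simp add: E_def)
      show "mdiam Y (E n) \<le> ennreal \<delta>" for n
        using C(1,2)[of n] order_trans[OF _ ennreal_leI[OF \<delta>'(2)]]
        by (auto simp: E_def mdiam_closure_of mdiam_le_iff[of _ "{}"])
      have "mtopology_of Y closure_of D \<subseteq> mtopology_of Y closure_of (\<Union>n\<in>{..N}. C n)"
        by (intro closure_of_mono cover)
      \<comment> \<open>Finiteness of the cover enters here: closure commutes with finite
        unions.\<close>
      also have "\<dots> = (\<Union>n\<le>N. mtopology_of Y closure_of C n)"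
        by (simp add: closure_of_Union image_image)
      also have "\<dots> \<subseteq> (\<Union>n. E n)" by (auto simp: E_def)
      finally show "mtopology_of Y closure_of D \<subseteq> (\<Union>n. E n)" .
    qed
    also have "\<dots> = (\<Sum>n\<le>N. gauge_cost Y (\<lambda>r. r powr s) (E n))"
      by (rule suminf_finite) (auto simp: E_def gauge_cost_empty[OF gauge_fun_powr[OF s]])
    also have "\<dots> \<le> (\<Sum>n\<le>N. ennreal e * gauge_cost Y h (C n))"
      using cost by (intro sum_mono) auto
    also have "\<dots> = ennreal e * (\<Sum>n\<le>N. gauge_cost Y h (C n))"
      by (simp add: sum_distrib_left)
    \<comment> \<open>The bound 1 on the total \<open>h\<close>-cost suffices, because the factor
      \<open>e\<close> gained from comparing the gauges is arbitrary.\<close>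
    also have "\<dots> \<le> ennreal e * 1" using small by (intro mult_left_mono) auto
    finally show ?thesis by simp
  qed
  then show "hausdorff_delta Y (\<lambda>r. r powr s) \<delta> (mtopology_of Y closure_of D) = 0"
    by (rule ennreal_eq_0I)
qed

section \<open>The equivalences\<close>

lemma upper_hausdorff_null_imp_sharp_measure_zero:
  fixes X :: "'a metric"
  assumes null: "\<And>h. gauge_fun h \<Longrightarrow> upper_hausdorff_meas X h (mspace X) = 0"
  shows "sharp_measure_zero TYPE('b) X"
  unfolding sharp_measure_zero_def
proof (intro allI impI, elim conjE)
  fix Y :: "'b metric" and f
  assume Y: "mcomplete_of Y" and f: "uniformly_continuous_map X Y f"
  \<comment> \<open>One gauge serves all exponents, so the decomposition \<open>C\<close>, and with
    it \<open>?K\<close>, does not depend on the exponent \<open>s\<close>.\<close>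
  let ?h = "\<lambda>r::real. 1 / ln (1 + 1 / r)"
  have "upper_hausdorff_meas Y ?h (f ` mspace X) = 0"
    by (intro upper_hausdorff_meas_uniformly_continuous_image[OF f gauge_fun_inverse_ln] null)
  also have "0 < (1 :: ennreal)" by simp
  finally obtain C :: "nat \<Rightarrow> 'b set" where C: "\<And>n. C n \<subseteq> mspace Y" "f ` mspace X \<subseteq> (\<Union>n. C n)"
    "(\<Sum>n. upper_hausdorff_0 Y ?h (C n)) < 1"
    by (rule upper_hausdorff_meas_lessE) blast
  \<comment> \<open>This single bound serves twice: finiteness gives compact closures, and a value
    below 1 gives closures that are null for every power.\<close>
  have lt: "upper_hausdorff_0 Y ?h (C n) < 1" for n
    using sum_le_suminf[of "\<lambda>n. upper_hausdorff_0 Y ?h (C n)" "{n}"] C(3) by auto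
  let ?K = "\<Union>n. mtopology_of Y closure_of C n"
  have "sigma_compact_in (mtopology_of Y) ?K"
    unfolding sigma_compact_in_def
  proof (intro exI conjI allI)
    show "compactin (mtopology_of Y) (mtopology_of Y closure_of C n)" for n
      by (rule compactin_closure_of_upper_hausdorff_0[OF Y C(1) less_trans[OF lt]]) simp
  qed (rule refl)
  moreover have "C n \<subseteq> mtopology_of Y closure_of C n" for n
    by (rule closure_of_subset) (simp add: C)
  then have "f ` mspace X \<subseteq> ?K" by (intro order_trans[OF C(2)] UN_mono order_refl)
  moreover have "hausdorff_dim Y ?K = 0"
    by (intro hausdorff_dim_eq_0I hausdorff_meas_UN_eq_0 hausdorff_meas_closure_of_eq_0 C lt)
  ultimately show "\<exists>K. sigma_compact_in (mtopology_of Y) K \<and> f ` mspace X \<subseteq> K \<and> hausdorff_dim Y K = 0"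
    by blast
qed

lemma sharp_measure_zero_imp_upper_hausdorff_null:
  fixes X :: "'a metric"
  assumes sharp: "sharp_measure_zero TYPE('a \<Rightarrow> real) X" and h: "gauge_fun h"
  shows "upper_hausdorff_meas X h (mspace X) = 0"
proof -
  obtain \<rho> where \<rho>: "uniformly_equivalent_metrics X \<rho>"
    and diam: "\<And>E. E \<subseteq> mspace X \<Longrightarrow> mdiam X E \<le> mdiam \<rho> E"
    and cost: "\<And>E. E \<subseteq> mspace X \<Longrightarrow> mdiam \<rho> E < 1 \<Longrightarrow> gauge_cost X h E \<le> mdiam \<rho> E"
    using uniformly_equivalent_metric_gauge[OF h] by blast
  have space: "mspace \<rho> = mspace X" and id: "uniformly_continuous_map X \<rho> id"
    using \<rho> by (auto simp: uniformly_equivalent_metrics_def)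
  \<comment> \<open>The completion of \<open>\<rho>\<close> is realized by real functions on
    \<open>'a\<close>, which is where the type parameter \<open>'a \<Rightarrow> real\<close> comes
    from.\<close>
  obtain e :: "'a \<Rightarrow> 'a \<Rightarrow> real" and Y where Y: "mcomplete_of Y" and e: "e \<in> mspace X \<rightarrow> mspace Y"
    and iso: "\<And>x y. x \<in> mspace X \<Longrightarrow> y \<in> mspace X \<Longrightarrow> mdist Y (e x) (e y) = mdist \<rho> x y"
    using Metric_space.metric_completion[OF Metric_space_mspace_mdist[of \<rho>]] space by metis
  have "uniformly_continuous_map X Y e"
    using id e iso by (auto simp: uniformly_continuous_map_def)
  then obtain C where C: "\<And>n. compactin (mtopology_of Y) (C n)"
    and sub: "e ` mspace X \<subseteq> (\<Union>n. C n)" and dim: "hausdorff_dim Y (\<Union>n::nat. C n) = 0"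
    using sharp Y unfolding sharp_measure_zero_def sigma_compact_in_def by metis
  \<comment> \<open>The inverse of the embedding, as a relation: points of \<open>C n\<close>
    outside the image of \<open>X\<close> simply have no partner.\<close>
  define R where "R = {(e x, x) | x. x \<in> mspace X}"
  have "upper_hausdorff_0 X h (R `` C n) \<le> upper_hausdorff_0 Y (\<lambda>r. r powr 1) (C n)" for n
  proof (rule upper_hausdorff_0_Image_le)
    show "R `` mspace Y \<subseteq> mspace X" by (auto simp: R_def)
    fix \<delta> :: real assume \<delta>: "\<delta> > 0"
    \<comment> \<open>The scale \<open>1 / 2\<close> keeps the \<open>\<rho>\<close>-diameters below
      1, where \<open>cost\<close> applies.\<close>
    have "mdiam X (R `` E) \<le> ennreal \<delta> \<and> gauge_cost X h (R `` E) \<le> gauge_cost Y (\<lambda>r. r powr 1) E"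
      if E: "mdiam Y E \<le> ennreal (min \<delta> (1 / 2))" for E
    proof -
      have RE: "R `` E \<subseteq> mspace X" by (auto simp: R_def)
      have le: "mdiam \<rho> (R `` E) \<le> mdiam Y E"
        using mdist_le_mdiam[of _ E _ Y] by (auto simp: mdiam_le_iff R_def simp flip: iso)
      have Y: "mdiam Y E \<le> ennreal \<delta>" "mdiam Y E < ennreal 1"
        by (rule order_trans[OF E], simp add: ennreal_leI)
          (rule le_less_trans[OF E], rule ennreal_lessI, auto)
      have "mdiam \<rho> (R `` E) < 1" using le_less_trans[OF le Y(2)] by simp
      then have "gauge_cost X h (R `` E) \<le> mdiam Y E" using order_trans[OF cost[OF RE] le] by blast
      moreover have "mdiam X (R `` E) \<le> ennreal \<delta>"
        using order_trans[OF diam[OF RE] order_trans[OF le Y(1)]] .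
      ultimately show ?thesis by (simp only: gauge_cost_powr_1[OF E] simp_thms)
    qed
    then show "\<exists>\<delta>'>0. \<forall>E\<subseteq>mspace Y. mdiam Y E \<le> ennreal \<delta>' \<longrightarrow>
        mdiam X (R `` E) \<le> ennreal \<delta> \<and> gauge_cost X h (R `` E) \<le> gauge_cost Y (\<lambda>r. r powr 1) E"
      using \<delta> by (intro exI[of _ "min \<delta> (1 / 2)"]) auto
  qed
  moreover have "upper_hausdorff_0 Y (\<lambda>r. r powr 1) (C n) = 0" for n
    by (rule upper_hausdorff_0_compact_eq_0[OF dim C]) blast
  ultimately have 0: "upper_hausdorff_0 X h (R `` C n) = 0" for n by simp
  have "mspace X \<subseteq> (\<Union>n. R `` C n)"
    using sub by (fastforce simp: R_def)
  then have "upper_hausdorff_meas X h (mspace X) \<le> (\<Sum>n. upper_hausdorff_0 X h (R `` C n))"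
    by (intro upper_hausdorff_meas_le) (auto simp: R_def)
  then show ?thesis by (simp add: 0)
qed

section \<open>Upper Hausdorff dimension of images and of equivalent metrics\<close>

lemma upper_hausdorff_null_imp_dim_image:
  assumes "\<And>h. gauge_fun h \<Longrightarrow> upper_hausdorff_meas X h (mspace X) = 0" "uniformly_continuous_map X Y f"
  shows "upper_hausdorff_dim Y (f ` mspace X) = 0"
  unfolding upper_hausdorff_dim_eq_0_iff
proof (intro allI impI)
  fix e :: real assume "e > 0"
  then have "upper_hausdorff_meas Y (\<lambda>r. r powr (e / 2)) (f ` mspace X) = 0"
    by (intro upper_hausdorff_meas_uniformly_continuous_image[OF assms(2)] gauge_fun_powr assms(1)) auto
  then show "\<exists>s. 0 < s \<and> s < e \<and> upper_hausdorff_meas Y (\<lambda>r. r powr s) (f ` mspace X) = 0"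
    using \<open>e > 0\<close> by (intro exI[of _ "e / 2"]) auto
qed

text \<open>For the metric \<open>\<rho>\<close> adapted to \<open>h\<close>, dimension zero
  provides a null exponent \<open>s < 1\<close>. On sets of \<open>\<rho>\<close>-diameter below 1
  the \<open>h\<close>-cost is at most that diameter, hence at most its power \<open>s\<close>, so
  covers transfer along \<open>Id\<close>.\<close>

lemma upper_hausdorff_dim_0_imp_null:
  assumes dim: "\<And>\<rho>. uniformly_equivalent_metrics X \<rho> \<Longrightarrow> upper_hausdorff_dim \<rho> (mspace \<rho>) = 0"
    and h: "gauge_fun h"
  shows "upper_hausdorff_meas X h (mspace X) = 0"
proof -
  obtain \<rho> where \<rho>: "uniformly_equivalent_metrics X \<rho>"
    and diam: "\<And>E. E \<subseteq> mspace X \<Longrightarrow> mdiam X E \<le> mdiam \<rho> E"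
    and cost: "\<And>E. E \<subseteq> mspace X \<Longrightarrow> mdiam \<rho> E < 1 \<Longrightarrow> gauge_cost X h E \<le> mdiam \<rho> E"
    using uniformly_equivalent_metric_gauge[OF h] by blast
  have space: "mspace \<rho> = mspace X" using \<rho> by (simp add: uniformly_equivalent_metrics_def)
  obtain s where s: "0 < s" "s < 1" and 0: "upper_hausdorff_meas \<rho> (\<lambda>r. r powr s) (mspace X) = 0"
    using dim[OF \<rho>] space unfolding upper_hausdorff_dim_eq_0_iff by (metis zero_less_one)
  have "upper_hausdorff_meas X h (Id `` mspace X) \<le> upper_hausdorff_meas \<rho> (\<lambda>r. r powr s) (mspace X)"
  proof (rule upper_hausdorff_meas_Image_le)
    show "Id `` mspace \<rho> \<subseteq> mspace X" by (simp add: space)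
    fix \<delta> :: real assume \<delta>: "\<delta> > 0"
    have "mdiam X (Id `` E) \<le> ennreal \<delta> \<and> gauge_cost X h (Id `` E) \<le> gauge_cost \<rho> (\<lambda>r. r powr s) E"
      if E: "E \<subseteq> mspace \<rho>" "mdiam \<rho> E \<le> ennreal (min \<delta> (1 / 2))" for E
    proof -
      have EX: "E \<subseteq> mspace X" using E(1) by (simp add: space)
      have le: "mdiam \<rho> E \<le> ennreal \<delta>" "mdiam \<rho> E < ennreal 1"
        by (rule order_trans[OF E(2)], simp add: ennreal_leI)
          (rule le_less_trans[OF E(2)], rule ennreal_lessI, auto)
      then have lt: "mdiam \<rho> E < 1" by simp
      then have "mdiam \<rho> E \<le> gauge_cost \<rho> (\<lambda>r. r powr s) E"
        using s by (intro mdiam_le_gauge_cost_powr) auto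
      then show ?thesis using diam[OF EX] cost[OF EX lt] le(1) by auto
    qed
    then show "\<exists>\<delta>'>0. \<forall>E\<subseteq>mspace \<rho>. mdiam \<rho> E \<le> ennreal \<delta>' \<longrightarrow>
        mdiam X (Id `` E) \<le> ennreal \<delta> \<and> gauge_cost X h (Id `` E) \<le> gauge_cost \<rho> (\<lambda>r. r powr s) E"
      using \<delta> by (intro exI[of _ "min \<delta> (1 / 2)"]) auto
  qed
  then show ?thesis by (simp add: 0)
qed

text \<open>The identity onto the same points with the new metric is an admissible uniformly
  continuous map.\<close>

lemma upper_hausdorff_dim_image_imp_equivalent_metrics:
  fixes X :: "'a metric"
  assumes "\<And>Y f. uniformly_continuous_map X (Y :: 'a metric) f \<Longrightarrow> upper_hausdorff_dim Y (f ` mspace X) = 0"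
    and "uniformly_equivalent_metrics X \<rho>"
  shows "upper_hausdorff_dim \<rho> (mspace \<rho>) = 0"
  using assms(1)[of \<rho> id] assms(2) by (simp add: uniformly_equivalent_metrics_def)

(* The first three conjuncts are the equivalences, with target spaces in (i) and (iii) ranging over
   types large enough to represent all possible targets of maps from X; the last two conjuncts say
   that the conditions then give (i) and (iii) for targets over arbitrary types 'b and 'c. *)
theorem theorem3p7:
  fixes X :: "'a metric"
  shows
    "(sharp_measure_zero TYPE('a \<Rightarrow> real) X \<longleftrightarrow>
        (\<forall>h. gauge_fun h \<longrightarrow> upper_hausdorff_meas X h (mspace X) = 0)) \<and>
     ((\<forall>h. gauge_fun h \<longrightarrow> upper_hausdorff_meas X h (mspace X) = 0) \<longleftrightarrow>
        (\<forall>(Y :: 'a metric) f. uniformly_continuous_map X Y f \<longrightarrow>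
            upper_hausdorff_dim Y (f ` mspace X) = 0)) \<and>
     ((\<forall>(Y :: 'a metric) f. uniformly_continuous_map X Y f \<longrightarrow>
            upper_hausdorff_dim Y (f ` mspace X) = 0) \<longleftrightarrow>
        (\<forall>\<rho> :: 'a metric. uniformly_equivalent_metrics X \<rho> \<longrightarrow>
            upper_hausdorff_dim \<rho> (mspace \<rho>) = 0)) \<and>
     (sharp_measure_zero TYPE('a \<Rightarrow> real) X \<longrightarrow> sharp_measure_zero TYPE('b) X) \<and>
     ((\<forall>(Y :: 'a metric) f. uniformly_continuous_map X Y f \<longrightarrow>
            upper_hausdorff_dim Y (f ` mspace X) = 0) \<longrightarrow>
        (\<forall>(Y :: 'c metric) f. uniformly_continuous_map X Y f \<longrightarrow>
            upper_hausdorff_dim Y (f ` mspace X) = 0))"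
proof -
  let ?null = "\<forall>h. gauge_fun h \<longrightarrow> upper_hausdorff_meas X h (mspace X) = 0"
  let ?image = "\<forall>(Y :: 'a metric) f. uniformly_continuous_map X Y f \<longrightarrow>
      upper_hausdorff_dim Y (f ` mspace X) = 0"
  let ?equiv = "\<forall>\<rho> :: 'a metric. uniformly_equivalent_metrics X \<rho> \<longrightarrow>
      upper_hausdorff_dim \<rho> (mspace \<rho>) = 0"
  have sharp_null: "sharp_measure_zero TYPE('a \<Rightarrow> real) X \<Longrightarrow> ?null"
    using sharp_measure_zero_imp_upper_hausdorff_null by blast
  have null_sharp: "?null \<Longrightarrow> sharp_measure_zero TYPE('a \<Rightarrow> real) X"
    by (rule upper_hausdorff_null_imp_sharp_measure_zero) blast
  have null_sharp': "?null \<Longrightarrow> sharp_measure_zero TYPE('b) X"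
    by (rule upper_hausdorff_null_imp_sharp_measure_zero) blast
  have null_image: "?null \<Longrightarrow> ?image"
    using upper_hausdorff_null_imp_dim_image by blast
  have null_image': "?null \<Longrightarrow> \<forall>(Y :: 'c metric) f. uniformly_continuous_map X Y f \<longrightarrow>
      upper_hausdorff_dim Y (f ` mspace X) = 0"
    using upper_hausdorff_null_imp_dim_image by blast
  have image_equiv: "?image \<Longrightarrow> ?equiv"
    using upper_hausdorff_dim_image_imp_equivalent_metrics by blast
  have equiv_null: "?equiv \<Longrightarrow> ?null"
    using upper_hausdorff_dim_0_imp_null by blast
  show ?thesis
    using sharp_null null_sharp null_sharp' null_image null_image' image_equiv equiv_null by argo
qed

end
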